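(* Let $X$ be a vector space with a semi-norm $\|\cdot\|_X$, $C\subseteq X$, $\omega\in\mathbb{R}$, $L\ge1$, and let $\{T_t\}_{t\ge0}$ be a family of mappings $T_t:C\to C$ satisfying $$\|T_tu_0-T_t\hat u_0\|_X\le L e^{\omega t}\|u_0-\hat u_0\|_X\quad\text{for all }t\ge0,\ u_0,\hat u_0\in C,$$ $$\lambda^{-1}T_{\lambda t}u_0=T_t[\lambda^{-1}u_0]\quad\text{for all }\lambda>0,\ t\ge0,\ u_0\in C,$$ and $T_t0=0$ for all $t\ge0$. Then for every $u_0\in C$ and $t,h>0$, $$\|T_{t+h}u_0-T_tu_0\|_X\le 2\,\frac ht\,L\,e^{\omega t}\|u_0\|_X.$$ In particular, $$\limsup_{h\to0+}\frac{\|T_{t+h}u_0-T_tu_0\|_X}{h}\le 2Le^{\omega t}\frac{\|u_0\|_X}{t}\quad\text{for every }t>0,\ u_0\in C.$$ Moreover, if the right-hand derivative $\frac{d}{dt_+}T_tu_0$ exists in $X$ at $t>0$, then $$\left\|\frac{d}{dt_+}T_tu_0\right\|_X\le 2Le^{\omega t}\frac{\|u_0\|_X}{t}.$$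
   Context: Implicitly in the hypotheses, $0\in C$ and $\lambda^{-1}u_0\in C$ for all $u_0\in C$, $\lambda>0$. The right-hand derivative is $\frac{d}{dt_+}T_tu_0=\lim_{h\to0+}\frac{T_{t+h}u_0-T_tu_0}{h}$ in $X$. *)

theory Defs
  imports "HOL-Analysis.Analysis"
begin

definition seminorm :: "('a::real_vector \<Rightarrow> real) \<Rightarrow> bool" where
  "seminorm p \<longleftrightarrow>
     (\<forall>x. 0 \<le> p x) \<and>
     (\<forall>a x. p (a *\<^sub>R x) = \<bar>a\<bar> * p x) \<and>
     (\<forall>x y. p (x + y) \<le> p x + p y)"

(* The limit is taken in the (possibly non-Hausdorff) topology of the semi-norm p.
   The derivative is therefore a relation: D is determined only up to elements of
   p-value zero, and p D does not depend on the choice of D. *)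
definition has_right_derivative ::
    "('a::real_vector \<Rightarrow> real) \<Rightarrow> (real \<Rightarrow> 'a) \<Rightarrow> 'a \<Rightarrow> real \<Rightarrow> bool" where
  "has_right_derivative p f D t \<longleftrightarrow>
     ((\<lambda>h. p ((1 / h) *\<^sub>R (f (t + h) - f t) - D)) \<longlongrightarrow> 0) (at_right 0)"

end

(* By homogeneity, a time increment is a rescaling of the datum: with c = 1 + h/t,
   T (t + h) u = c T t (u / c), so
   T (t + h) u - T t u = c (T t (u / c) - T t u) + (c - 1) T t u,
   and the Lipschitz bound (together with T t 0 = 0) makes each of the two terms at most
   (c - 1) L exp (omega t) p u. *)

theory Submission
  imports Defs
begin

lemma seminorm_scaleR: "seminorm p \<Longrightarrow> p (a *\<^sub>R x) = \<bar>a\<bar> * p x"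
  by (simp add: seminorm_def)

lemma seminorm_triangle: "seminorm p \<Longrightarrow> p (x + y) \<le> p x + p y"
  by (simp add: seminorm_def)

lemma seminorm_minus: "seminorm p \<Longrightarrow> p (- x) = p x"
  using seminorm_scaleR[of p "- 1" x] by simp

text \<open>Here \<open>t\<close> and \<open>u\<close> are fixed, and \<open>M\<close> stands for
  the Lipschitz constant at time \<open>t\<close>. Time \<open>t + h\<close> enters through
  homogeneity alone, so no Lipschitz bound at that later time is used; hence the exponential in the
  final estimate is taken at \<open>t\<close> and not at \<open>t + h\<close>.\<close>

lemma homogeneous_increment_le:
  fixes p :: "'a::real_vector \<Rightarrow> real"
  assumes p: "seminorm p"
    and "t > 0" "h > 0" "u \<in> C" "0 \<in> C"
    and cone: "\<And>c. c > 0 \<Longrightarrow> inverse c *\<^sub>R u \<in> C"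
    and lip: "\<And>v w. v \<in> C \<Longrightarrow> w \<in> C \<Longrightarrow> p (T t v - T t w) \<le> M * p (v - w)"
    and hom: "\<And>c. c > 0 \<Longrightarrow> inverse c *\<^sub>R T (c * t) u = T t (inverse c *\<^sub>R u)"
    and zero: "T t 0 = 0"
  shows "p (T (t + h) u - T t u) \<le> 2 * (h / t) * (M * p u)"
proof -
  define c where "c = 1 + h / t"
  have c: "c > 1" "c * t = t + h"
    using assms(2,3) by (auto simp: c_def field_simps)
  define v where "v = inverse c *\<^sub>R u"
  have v: "v \<in> C"
    using cone[of c] c by (simp add: v_def)
  have "T (t + h) u = c *\<^sub>R (inverse c *\<^sub>R T (c * t) u)"
    using c by simp
  also have "\<dots> = c *\<^sub>R T t v"
    using hom[of c] c by (simp add: v_def)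
  finally have "T (t + h) u - T t u = c *\<^sub>R (T t v - T t u) + (c - 1) *\<^sub>R T t u"
    by (simp add: algebra_simps)
  then have le: "p (T (t + h) u - T t u) \<le> c * p (T t v - T t u) + (c - 1) * p (T t u)"
    using seminorm_triangle[OF p, of "c *\<^sub>R (T t v - T t u)" "(c - 1) *\<^sub>R T t u"] c
    by (simp add: seminorm_scaleR[OF p])
  have "v - u = (inverse c - 1) *\<^sub>R u"
    by (simp add: v_def algebra_simps)
  then have "p (v - u) = \<bar>inverse c - 1\<bar> * p u"
    by (simp only: seminorm_scaleR[OF p])
  \<comment> \<open>Since \<open>c > 1\<close>, the absolute value is 1 - 1/c. Its denominator
    cancels below against the factor \<open>c\<close> in front of the first term.\<close>
  also have "\<bar>inverse c - 1\<bar> = (c - 1) / c"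
    using c by (simp add: field_simps)
  finally have "p (T t v - T t u) \<le> M * ((c - 1) / c * p u)"
    using lip[OF v \<open>u \<in> C\<close>] by simp
  then have "c * p (T t v - T t u) \<le> c * (M * ((c - 1) / c * p u))"
    using c by (intro mult_left_mono) auto
  moreover have "c * (M * ((c - 1) / c * p u)) = (c - 1) * (M * p u)"
    using c by simp
  moreover have "(c - 1) * p (T t u) \<le> (c - 1) * (M * p u)"
    using lip[OF \<open>u \<in> C\<close> \<open>0 \<in> C\<close>] zero c by (intro mult_left_mono) auto
  \<comment> \<open>The factor 2 counts the two equal contributions, and \<open>c - 1\<close> is
    \<open>h / t\<close>.\<close>
  ultimately have "p (T (t + h) u - T t u) \<le> 2 * (c - 1) * (M * p u)"
    using le by linarith
  then show ?thesis
    by (simp add: c_def)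
qed

text \<open>Convergence is measured by \<open>p\<close> itself, so the triangle inequality bounds
  \<open>p D\<close> by \<open>K\<close> plus an error that tends to 0. Uniqueness of the limit is
  never invoked, so the bound covers every representative \<open>D\<close>.\<close>

lemma seminorm_right_derivative_le:
  assumes p: "seminorm p"
    and der: "has_right_derivative p f D t"
    and bound: "\<And>h. h > 0 \<Longrightarrow> p (f (t + h) - f t) / h \<le> K"
  shows "p D \<le> K"
proof -
  let ?q = "\<lambda>h. (1 / h) *\<^sub>R (f (t + h) - f t)"
  have "p D \<le> p (?q h - D) + K" if "h > 0" for h
  proof -
    have "p D \<le> p (- (?q h - D)) + p (?q h)"
      using seminorm_triangle[OF p, of "- (?q h - D)" "?q h"] by simp
    also have "p (?q h) = p (f (t + h) - f t) / h"
      using that by (simp only: seminorm_scaleR[OF p]) simp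
    also have "\<dots> \<le> K"
      using bound that .
    finally show ?thesis
      by (simp only: seminorm_minus[OF p])
  qed
  then have "\<forall>\<^sub>F h in at_right 0. p D \<le> p (?q h - D) + K"
    using eventually_at_right_less[of "0::real"] by (auto elim: eventually_mono)
  moreover have "((\<lambda>h. p (?q h - D) + K) \<longlongrightarrow> 0 + K) (at_right 0)"
    using der unfolding has_right_derivative_def by (intro tendsto_add tendsto_const)
  \<comment> \<open>The left side does not depend on \<open>h\<close>, so the inequality passes to
    the limit along the nontrivial filter \<open>at_right 0\<close>.\<close>
  ultimately have "p D \<le> 0 + K"
    by (intro tendsto_lowerbound) auto
  then show ?thesis
    by simp
qed

theorem corollary2p4:
  fixes p :: "'a::real_vector \<Rightarrow> real"
    and C :: "'a set"
    and \<omega> L :: real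
    and T :: "real \<Rightarrow> 'a \<Rightarrow> 'a"
  assumes "seminorm p"
    and "L \<ge> 1"
    and "0 \<in> C"
    and "\<And>c u. c > 0 \<Longrightarrow> u \<in> C \<Longrightarrow> inverse c *\<^sub>R u \<in> C"
    and "\<And>t u. t \<ge> 0 \<Longrightarrow> u \<in> C \<Longrightarrow> T t u \<in> C"
    and "\<And>t u v. t \<ge> 0 \<Longrightarrow> u \<in> C \<Longrightarrow> v \<in> C \<Longrightarrow>
           p (T t u - T t v) \<le> L * exp (\<omega> * t) * p (u - v)"
    and "\<And>c t u. c > 0 \<Longrightarrow> t \<ge> 0 \<Longrightarrow> u \<in> C \<Longrightarrow>
           inverse c *\<^sub>R T (c * t) u = T t (inverse c *\<^sub>R u)"
    and "\<And>t. t \<ge> 0 \<Longrightarrow> T t 0 = 0"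
  shows "(\<forall>u\<in>C. \<forall>t>0. \<forall>h>0.
            p (T (t + h) u - T t u) \<le> 2 * (h / t) * L * exp (\<omega> * t) * p u)
       \<and> (\<forall>u\<in>C. \<forall>t>0.
            Limsup (at_right 0) (\<lambda>h. ereal (p (T (t + h) u - T t u) / h))
              \<le> ereal (2 * L * exp (\<omega> * t) * (p u / t)))
       \<and> (\<forall>u\<in>C. \<forall>t>0. \<forall>D.
            has_right_derivative p (\<lambda>s. T s u) D t \<longrightarrow>
              p D \<le> 2 * L * exp (\<omega> * t) * (p u / t))"
proof -
  have incr: "p (T (t + h) u - T t u) \<le> 2 * (h / t) * (L * exp (\<omega> * t) * p u)"
    if "u \<in> C" "t > 0" "h > 0" for u t h
    by (rule homogeneous_increment_le[where T = T and C = C]) (use assms that in auto)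
  \<comment> \<open>The increment bound is linear in \<open>h\<close>, so division by
    \<open>h\<close> leaves a constant valid for all \<open>h > 0\<close>. This uniform bound yields
    both the limsup estimate and the derivative estimate.\<close>
  have quot: "p (T (t + h) u - T t u) / h \<le> 2 * L * exp (\<omega> * t) * (p u / t)"
    if "u \<in> C" "t > 0" "h > 0" for u t h
    using incr[OF that] that by (simp add: field_simps)
  have "Limsup (at_right 0) (\<lambda>h. ereal (p (T (t + h) u - T t u) / h))
      \<le> ereal (2 * L * exp (\<omega> * t) * (p u / t))" if "u \<in> C" "t > 0" for u t
    using eventually_at_right_less[of "0::real"] quot[OF that]
    by (intro Limsup_bounded) (auto elim: eventually_mono)
  moreover have "p D \<le> 2 * L * exp (\<omega> * t) * (p u / t)"
    if "u \<in> C" "t > 0" "has_right_derivative p (\<lambda>s. T s u) D t" for u t D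
    using seminorm_right_derivative_le[OF assms(1) that(3)] quot[OF that(1,2)] by blast
  ultimately show ?thesis
    using incr by (auto simp: mult.assoc)
qed

end
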